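(* Let $(\mathbf{A}_N)_{N\ge 1}$ be a sequence of $N\times N$ random matrices with real eigenvalues such that $\mathbf{A}_N\mapsto A\in\mathcal{M}_{\mathrm{alg}}$, and let $p,q,r,s$ be real scalars. Suppose that $r$ and $s$ are not both zero, and that the limiting distribution of $\mathbf{A}_N$ has no atom at $-s/r$ (this condition being vacuous if $r=0$). Then the matrices $$\mathbf{B}_N=(p\,\mathbf{A}_N+q\,\mathbf{I}_N)(r\,\mathbf{A}_N+s\,\mathbf{I}_N)^{-1}$$ (where $r\,\mathbf{A}_N+s\,\mathbf{I}_N$ is assumed invertible, so that $\mathbf{B}_N$ is defined) satisfy $\mathbf{B}_N\mapsto B\in\mathcal{M}_{\mathrm{alg}}$.
   Context: For an $N\times N$ matrix $\mathbf{M}$ with real eigenvalues, let $F^{\mathbf{M}}(x)=\frac1N\#\{\text{eigenvalues of }\mathbf{M}\le x\}$ (counted with multiplicity). For a sequence of random matrices $\mathbf{A}_N$ of size $N\times N$ with real eigenvalues, $\mathbf{A}_N\mapsto A$ means that there is a non-random probability distribution function $F^A$ on $\mathbb{R}$ such that, almost surely, $F^{\mathbf{A}_N}(x)\to F^A(x)$ as $N\to\infty$ at every continuity point $x$ of $F^A$; here $A$ is only a symbol naming the limit. The Stieltjes transform of $F^A$ is $m_A(z)=\int\frac{1}{x-z}\,dF^A(x)$ for $z\in\mathbb{C}^+$ (the open upper half plane). The distribution $F^A$ is algebraic if there is a nonzero bivariate polynomial $L(m,z)$ with real coefficients such that $L(m_A(z),z)=0$ for all $z\in\mathbb{C}^+$.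 One writes $\mathbf{A}_N\mapsto A\in\mathcal{M}_{\mathrm{alg}}$ if $\mathbf{A}_N\mapsto A$ and $F^A$ is algebraic. The conclusion $\mathbf{B}_N\mapsto B\in\mathcal{M}_{\mathrm{alg}}$ asserts both that the limiting distribution $F^B$ exists and that it is algebraic. *)

theory Defs
  imports "HOL-Probability.Probability" "Jordan_Normal_Form.Char_Poly"
begin

(* Matrices have complex entries, which includes the real ones. *)
definition real_spectrum :: "complex mat \<Rightarrow> bool" where
  "real_spectrum X \<longleftrightarrow> (\<forall>k. eigenvalue X k \<longrightarrow> k \<in> \<real>)"

(* The distribution function F^X. The eigenvalues with algebraic multiplicity are the multiset of
   roots of the characteristic polynomial. Re only converts the type: the function is used for
   matrices with real spectrum. *)
definition esd :: "complex mat \<Rightarrow> real \<Rightarrow> real" where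
  "esd X x = real (size {# k \<in># proots (char_poly X). Re k \<le> x #}) / real (dim_row X)"

definition random_mat :: "'w measure \<Rightarrow> nat \<Rightarrow> ('w \<Rightarrow> complex mat) \<Rightarrow> bool" where
  "random_mat P N X \<longleftrightarrow>
     (\<forall>w \<in> space P. X w \<in> carrier_mat N N) \<and>
     (\<forall>i < N. \<forall>j < N. (\<lambda>w. X w $$ (i, j)) \<in> borel_measurable P)"

(* The relation A_N |-> A, the symbol A being represented by the law mu whose distribution
   function is F^A. The index 0 carries no condition. *)
definition limit_law ::
    "'w measure \<Rightarrow> (nat \<Rightarrow> 'w \<Rightarrow> complex mat) \<Rightarrow> real measure \<Rightarrow> bool" where
  "limit_law P A \<mu> \<longleftrightarrow>
     (\<forall>N \<ge> 1. random_mat P N (A N) \<and> (AE w in P. real_spectrum (A N w))) \<and>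
     real_distribution \<mu> \<and>
     (AE w in P. weak_conv (\<lambda>N. esd (A N w)) (cdf \<mu>))"

definition stieltjes :: "real measure \<Rightarrow> complex \<Rightarrow> complex" where
  "stieltjes \<mu> z = (\<integral>x. 1 / (complex_of_real x - z) \<partial>\<mu>)"

(* The value L(m, z), where the outer variable of L is m and the inner one is z. *)
definition eval2 :: "real poly poly \<Rightarrow> complex \<Rightarrow> complex \<Rightarrow> complex" where
  "eval2 L m z = poly (map_poly (\<lambda>c. poly (map_poly complex_of_real c) z) L) m"

definition algebraic_law :: "real measure \<Rightarrow> bool" where
  "algebraic_law \<mu> \<longleftrightarrow>
     (\<exists>L. L \<noteq> 0 \<and> (\<forall>z. Im z > 0 \<longrightarrow> eval2 L (stieltjes \<mu> z) z = 0))"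

(* Total inverse: singular matrices get the zero matrix. *)
definition inv_mat :: "complex mat \<Rightarrow> complex mat" where
  "inv_mat X = (case mat_inverse X of Some Y \<Rightarrow> Y | None \<Rightarrow> 0\<^sub>m (dim_row X) (dim_row X))"

definition lin_mat :: "real \<Rightarrow> real \<Rightarrow> complex mat \<Rightarrow> complex mat" where
  "lin_mat a b X = complex_of_real a \<cdot>\<^sub>m X + complex_of_real b \<cdot>\<^sub>m 1\<^sub>m (dim_row X)"

end

theory Submission
  imports Defs
begin

text \<open>
  Write \<open>f x = (p x + q) / (r x + s)\<close>; the limit is the image of \<open>\<mu>\<close> under \<open>f\<close>. If \<open>l\<^sub>i\<close> are the
  eigenvalues of \<open>A\<close>, then \<open>det (a A + b I)\<close> is the product of the \<open>a l\<^sub>i + b\<close>, and comparing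
  \<open>det (k I - B) det (r A + s I) = det ((k r - p) A + (k s - q) I)\<close> for all \<open>k\<close> shows that
  \<open>B\<close> has eigenvalues \<open>f l\<^sub>i\<close> with the same multiplicities. Hence the empirical measures are pushed
  forward by \<open>f\<close>, which is continuous off a \<open>\<mu>\<close>-null set, and the continuous mapping theorem applies.

  For algebraicity let \<open>D = p s - q r\<close>. If \<open>D = 0\<close>, the limit is a point mass. Otherwise the two
  Stieltjes transforms are related by \<open>m\<^sub>\<nu>(z) = r / (p - r z) + D / (p - r z)^2 * m\<^sub>\<mu>(w)\<close> with
  \<open>w = (s z - q) / (p - r z)\<close>. Solving for \<open>m\<^sub>\<mu>(w)\<close>, substituting into \<open>L\<close> and clearing
  denominators gives a polynomial relation for \<open>m\<^sub>\<nu>\<close>; it is nontrivial because the substitution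
  is invertible. When \<open>D < 0\<close> the point \<open>w\<close> lies in the lower half plane, where
  the relation for \<open>m\<^sub>\<mu>\<close> follows by conjugation since \<open>L\<close> is real.
\<close>

subsection \<open>Spectra of Moebius transforms of matrices\<close>

lemma lin_mat_carrier [simp]: "X \<in> carrier_mat n n \<Longrightarrow> lin_mat a b X \<in> carrier_mat n n"
  by (auto simp: lin_mat_def)

text \<open>For nonzero \<open>a\<close>, \<open>a X + b I\<close> is \<open>-a\<close> times
  \<open>k I - X\<close> with \<open>k = -b/a\<close>, so its determinant is \<open>(-a)^n\<close>
  times the characteristic polynomial at \<open>k\<close>. The case \<open>a = 0\<close> is separate
  because of the division by \<open>a\<close>.\<close>

lemma det_linear_combination:
  fixes X :: "'a::field mat"
  assumes X: "X \<in> carrier_mat n n"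
    and ls: "char_poly X = (\<Prod>l\<leftarrow>ls. [:- l, 1:])" "length ls = n"
  shows "det (a \<cdot>\<^sub>m X + b \<cdot>\<^sub>m 1\<^sub>m n) = (\<Prod>l\<leftarrow>ls. a * l + b)"
proof (cases "a = 0")
  case True
  have "a \<cdot>\<^sub>m X + b \<cdot>\<^sub>m 1\<^sub>m n = b \<cdot>\<^sub>m 1\<^sub>m n"
    using X True by (intro eq_matI) auto
  then show ?thesis
    using ls(2) True by (simp add: map_replicate_const prod_list_replicate)
next
  case False
  have eq: "a \<cdot>\<^sub>m X + b \<cdot>\<^sub>m 1\<^sub>m n = (- a) \<cdot>\<^sub>m (- char_matrix X (- b / a))"
    using X False by (intro eq_matI) (auto simp: char_matrix_def field_simps)
  have "det (a \<cdot>\<^sub>m X + b \<cdot>\<^sub>m 1\<^sub>m n) = (- a) ^ n * poly (char_poly X) (- b / a)"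
    unfolding eq det_smult char_poly_matrix[OF X] using char_matrix_closed[OF X, of "- b / a"] by simp
  also have "\<dots> = (\<Prod>l\<leftarrow>ls. a * l + b)"
    unfolding ls(1) ls(2)[symmetric] using False by (induction ls) (simp_all add: field_simps)
  finally show ?thesis .
qed

section \<open>Inverses through the adjugate\<close>

lemma det_invertible_mat:
  fixes X :: "'a::comm_ring_1 mat"
  assumes "X \<in> carrier_mat n n" "invertible_mat X"
  shows "det X \<noteq> 0"
proof -
  from assms obtain Y where Y: "X * Y = 1\<^sub>m n" "Y * X = 1\<^sub>m (dim_row Y)"
    by (auto simp: invertible_mat_def inverts_mat_def)
  \<comment> \<open>The size of \<open>Y\<close> is not part of invertibility; it is recovered by
    counting the columns of both products.\<close>
  have "dim_col (X * Y) = n" unfolding Y(1) by simp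
  moreover have "dim_col (Y * X) = dim_row Y" unfolding Y(2) by simp
  ultimately have "Y \<in> carrier_mat n n" using assms by auto
  then have "det X * det Y = 1" using det_mult[of X n Y] assms Y(1) by simp
  then show ?thesis by auto
qed

text \<open>\<open>mat_inverse\<close> runs Gauss-Jordan elimination. The adjugate formula expresses
  the same inverse through determinants, which makes both its algebra and its measurability
  accessible.\<close>

lemma inv_mat_eq_adj_mat:
  assumes X: "X \<in> carrier_mat n n"
  shows "inv_mat X = (if det X = 0 then 0\<^sub>m n n else (1 / det X) \<cdot>\<^sub>m adj_mat X)"
proof (cases "mat_inverse X")
  case None
  then have "det X = 0"
    using mat_inverse(1)[OF X, of "()"] det_non_zero_imp_unit[OF X, of "()"] by blast
  then show ?thesis using None X by (simp add: inv_mat_def)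
next
  case (Some Y)
  then have Y: "X * Y = 1\<^sub>m n" "Y * X = 1\<^sub>m n" "Y \<in> carrier_mat n n"
    using mat_inverse(2)[OF X] by auto
  have nz: "det X \<noteq> 0"
    using det_mult[OF X Y(3)] Y(1) by auto
  note adj = adj_mat[OF X]
  \<comment> \<open>The product \<open>adj_mat X * X * Y\<close> is bracketed in two ways.\<close>
  have "det X \<cdot>\<^sub>m Y = (det X \<cdot>\<^sub>m 1\<^sub>m n) * Y"
    using Y(3) by (simp add: mult_smult_assoc_mat[of _ n n _ n])
  also have "\<dots> = adj_mat X"
    unfolding adj(3)[symmetric] using Y(1) adj(1)
    by (simp add: assoc_mult_mat[OF adj(1) X Y(3)])
  finally have "(1 / det X) \<cdot>\<^sub>m adj_mat X = (1 / det X) \<cdot>\<^sub>m (det X \<cdot>\<^sub>m Y)" by simp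
  also have "\<dots> = Y" using nz by (intro eq_matI) auto
  finally show ?thesis using nz Some by (simp add: inv_mat_def)
qed

lemma inv_mat_carrier [simp]: "X \<in> carrier_mat n n \<Longrightarrow> inv_mat X \<in> carrier_mat n n"
  using adj_mat(1)[of X n] by (auto simp: inv_mat_eq_adj_mat)

lemma inv_mat_mult:
  assumes X: "X \<in> carrier_mat n n" and "det X \<noteq> 0"
  shows "inv_mat X * X = 1\<^sub>m n"
proof -
  have "inv_mat X * X = (1 / det X) \<cdot>\<^sub>m (adj_mat X * X)"
    using assms adj_mat(1)[OF X] by (simp add: inv_mat_eq_adj_mat mult_smult_assoc_mat[of _ n n _ n])
  also have "\<dots> = 1\<^sub>m n"
    unfolding adj_mat(3)[OF X] using assms by (intro eq_matI) auto
  finally show ?thesis .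
qed

text \<open>Working with determinants alone keeps track of algebraic multiplicities without
  diagonalising \<open>X\<close> or passing to a Jordan form.\<close>

lemma char_poly_moebius:
  fixes X :: "complex mat" and p q r s :: real
  assumes X: "X \<in> carrier_mat n n"
    and ls: "char_poly X = (\<Prod>l\<leftarrow>ls. [:- l, 1:])" "length ls = n"
    and inv: "invertible_mat (lin_mat r s X)"
  shows "char_poly (lin_mat p q X * inv_mat (lin_mat r s X)) =
    (\<Prod>l\<leftarrow>ls. [:- ((of_real p * l + of_real q) / (of_real r * l + of_real s)), 1:])"
proof -
  define R where "R = lin_mat r s X"
  define B where "B = lin_mat p q X * inv_mat R"
  have R: "R \<in> carrier_mat n n" and B: "B \<in> carrier_mat n n"
    using X by (auto simp: R_def B_def intro!: mult_carrier_mat[of _ n n])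
  have nz: "det R \<noteq> 0"
    using det_invertible_mat[OF R] inv by (simp add: R_def)
  have detR: "det R = (\<Prod>l\<leftarrow>ls. of_real r * l + of_real s)"
    using det_linear_combination[OF X ls] X by (simp add: R_def lin_mat_def)
  have BR: "B * R = lin_mat p q X"
    using X R unfolding B_def
    by (simp add: assoc_mult_mat[of _ n n _ n _ n] inv_mat_mult[OF R nz]
        right_mult_one_mat[OF lin_mat_carrier])
  \<comment> \<open>These are the factors of \<open>det R\<close>, so invertibility makes every
    quotient in the claimed spectrum genuine.\<close>
  have nz': "of_real r * l + of_real s \<noteq> 0" if "l \<in> set ls" for l
    using nz that unfolding detR by (auto simp: prod_list_zero_iff)
  have "poly (char_poly B) k =
      poly (\<Prod>l\<leftarrow>ls. [:- ((of_real p * l + of_real q) / (of_real r * l + of_real s)), 1:]) k" for k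
  proof -
    have "poly (char_poly B) k * det R = det (- char_matrix B k * R)"
      using B R by (simp add: char_poly_matrix[OF B] det_mult[of _ n])
    \<comment> \<open>Multiplying by \<open>R\<close> removes the inverse hidden in
      \<open>B\<close>; what remains is again a linear combination of \<open>X\<close> and the
      identity, whose determinant is known.\<close>
    also have "- char_matrix B k * R = k \<cdot>\<^sub>m R - B * R"
    proof -
      have "- char_matrix B k = k \<cdot>\<^sub>m 1\<^sub>m n - B"
        using B by (intro eq_matI) (auto simp: char_matrix_def)
      then show ?thesis
        using B R by (simp add: minus_mult_distrib_mat[of _ n n _ _ n] mult_smult_assoc_mat[of _ n n _ n])
    qed
    also have "\<dots> = (k * of_real r - of_real p) \<cdot>\<^sub>m X + (k * of_real s - of_real q) \<cdot>\<^sub>m 1\<^sub>m n"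
      unfolding BR using X by (intro eq_matI) (auto simp: R_def lin_mat_def algebra_simps)
    also have "det \<dots> = (\<Prod>l\<leftarrow>ls. (k * of_real r - of_real p) * l + (k * of_real s - of_real q))"
      by (rule det_linear_combination[OF X ls])
    also have "\<dots> = (\<Prod>l\<leftarrow>ls. (k - (of_real p * l + of_real q) / (of_real r * l + of_real s)) *
        (of_real r * l + of_real s))"
    proof (intro arg_cong[where f = prod_list] map_cong refl)
      fix l assume "l \<in> set ls"
      from nz'[OF this] show "(k * of_real r - of_real p) * l + (k * of_real s - of_real q) =
        (k - (of_real p * l + of_real q) / (of_real r * l + of_real s)) * (of_real r * l + of_real s)"
        by (simp add: field_simps)
    qed
    also have "\<dots> = (\<Prod>l\<leftarrow>ls. k - (of_real p * l + of_real q) / (of_real r * l + of_real s)) * det R"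
      unfolding detR by (induction ls) (simp_all add: mult_ac)
    finally show ?thesis
      using nz by (simp add: poly_prod_list o_def)
  qed
  then show ?thesis
    unfolding B_def R_def by (intro poly_eq_poly_eq_iff[THEN iffD1] ext)
qed

subsection \<open>Measurability\<close>

text \<open>By the Leibniz formula the determinant is a finite sum of signed products of
  entries.\<close>

lemma measurable_mat_det:
  assumes "\<And>w. w \<in> space P \<Longrightarrow> X w \<in> carrier_mat n n"
    and "\<And>i j. i < n \<Longrightarrow> j < n \<Longrightarrow> (\<lambda>w. X w $$ (i, j)) \<in> borel_measurable P"
  shows "(\<lambda>w. det (X w) :: complex) \<in> borel_measurable P"
proof -
  have "(\<lambda>w. \<Sum>\<pi> | \<pi> permutes {0..<n}. signof \<pi> * (\<Prod>i = 0..<n. X w $$ (i, \<pi> i)))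
      \<in> borel_measurable P"
    using assms(2) by (intro borel_measurable_sum borel_measurable_times borel_measurable_const
      borel_measurable_prod) (auto dest: permutes_in_image)
  then show ?thesis
    by (rule measurable_cong[THEN iffD1, rotated]) (simp add: det_def'[OF assms(1)])
qed

lemma random_mat_lin_mat:
  assumes "random_mat P n X"
  shows "random_mat P n (\<lambda>w. lin_mat a b (X w))"
  unfolding random_mat_def
proof (intro conjI ballI allI impI)
  fix i j assume ij: "i < n" "j < n"
  have [measurable]: "(\<lambda>w. X w $$ (i, j)) \<in> borel_measurable P"
    using assms ij by (simp add: random_mat_def)
  have "(\<lambda>w. of_real a * X w $$ (i, j) + of_real b * (if i = j then 1 else 0)) \<in> borel_measurable P"
    by measurable
  then show "(\<lambda>w. lin_mat a b (X w) $$ (i, j)) \<in> borel_measurable P"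
    by (rule measurable_cong[THEN iffD1, rotated])
       (use assms ij in \<open>auto simp: random_mat_def lin_mat_def\<close>)
qed (use assms in \<open>auto simp: random_mat_def\<close>)

lemma random_mat_mult:
  assumes "random_mat P n X" "random_mat P n Y"
  shows "random_mat P n (\<lambda>w. X w * Y w)"
  unfolding random_mat_def
proof (intro conjI ballI allI impI)
  fix i j assume ij: "i < n" "j < n"
  have "(\<lambda>w. \<Sum>k = 0..<n. X w $$ (i, k) * Y w $$ (k, j)) \<in> borel_measurable P"
    using assms ij by (intro borel_measurable_sum borel_measurable_times) (auto simp: random_mat_def)
  then show "(\<lambda>w. (X w * Y w) $$ (i, j)) \<in> borel_measurable P"
  proof (rule measurable_cong[THEN iffD1, rotated])
    fix w assume "w \<in> space P"
    then have "X w \<in> carrier_mat n n" "Y w \<in> carrier_mat n n"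
      using assms by (auto simp: random_mat_def)
    then show "(\<Sum>k = 0..<n. X w $$ (i, k) * Y w $$ (k, j)) = (X w * Y w) $$ (i, j)"
      using ij by (auto simp: scalar_prod_def)
  qed
qed (use assms in \<open>auto simp: random_mat_def intro!: mult_carrier_mat\<close>)

text \<open>On the measurable event \<open>det (X w) = 0\<close> the inverse is the constant zero
  matrix; elsewhere its entries are cofactors divided by the determinant.\<close>

lemma random_mat_inv_mat:
  assumes "random_mat P n X"
  shows "random_mat P n (\<lambda>w. inv_mat (X w))"
  unfolding random_mat_def
proof (intro conjI ballI allI impI)
  have X: "X w \<in> carrier_mat n n" if "w \<in> space P" for w
    using assms that by (simp add: random_mat_def)
  have X_meas: "(\<lambda>w. X w $$ (i, j)) \<in> borel_measurable P" if "i < n" "j < n" for i j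
    using assms that by (simp add: random_mat_def)
  fix i j assume ij: "i < n" "j < n"
  have [measurable]: "(\<lambda>w. det (X w)) \<in> borel_measurable P"
    by (rule measurable_mat_det[OF X X_meas])
  have [measurable]: "(\<lambda>w. det (mat_delete (X w) j i)) \<in> borel_measurable P"
  proof (rule measurable_mat_det[where n = "n - 1"])
    fix k l assume kl: "k < n - 1" "l < n - 1"
    \<comment> \<open>The indices of the minor skip the deleted row \<open>j\<close> and column
      \<open>i\<close>.\<close>
    have "(\<lambda>w. X w $$ (if k < j then k else Suc k, if l < i then l else Suc l)) \<in> borel_measurable P"
      using kl by (intro X_meas) auto
    then show "(\<lambda>w. mat_delete (X w) j i $$ (k, l)) \<in> borel_measurable P"
      by (rule measurable_cong[THEN iffD1, rotated])
         (use kl ij X in \<open>auto simp: mat_delete_def carrier_matD[OF X]\<close>)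
  qed (rule mat_delete_carrier[OF X])
  have "(\<lambda>w. if det (X w) = 0 then 0 else 1 / det (X w) * ((-1) ^ (j + i) * det (mat_delete (X w) j i)))
      \<in> borel_measurable P"
    by measurable
  then show "(\<lambda>w. inv_mat (X w) $$ (i, j)) \<in> borel_measurable P"
  proof (rule measurable_cong[THEN iffD1, rotated])
    fix w assume "w \<in> space P"
    from X[OF this] ij
    show "(if det (X w) = 0 then 0 else 1 / det (X w) * ((-1) ^ (j + i) * det (mat_delete (X w) j i)))
        = inv_mat (X w) $$ (i, j)"
      by (auto simp: inv_mat_eq_adj_mat adj_mat_def cofactor_def)
  qed
qed (use assms in \<open>auto simp: random_mat_def\<close>)

subsection \<open>Weak convergence\<close>

text \<open>Continuous mapping theorem: for a bounded continuous test function \<open>g\<close>, the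
  composition with \<open>f\<close> can be discontinuous only where \<open>f\<close> is, hence is
  continuous almost everywhere, and its integrals converge.\<close>

lemma weak_conv_m_distr:
  fixes f :: "real \<Rightarrow> real"
  assumes M_seq: "\<And>n. real_distribution (M_seq n)" and M: "real_distribution M"
    and conv: "weak_conv_m M_seq M"
    and f [measurable]: "f \<in> borel_measurable borel"
    and null: "emeasure M {x. \<not> isCont f x} = 0"
  shows "weak_conv_m (\<lambda>n. distr (M_seq n) borel f) (distr M borel f)"
proof -
  interpret M: real_distribution M by fact
  interpret M_seq: real_distribution "M_seq n" for n by fact
  have disc: "{x. \<not> isCont f x} \<in> sets M"
    using isCont_borel[of f] by (simp add: Collect_neg_eq borel_comp)
  show ?thesis
  proof (rule integral_bdd_continuous_conv_imp_weak_conv)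
    fix g :: "real \<Rightarrow> real"
    assume g: "\<And>x. isCont g x" "\<And>x. \<bar>g x\<bar> \<le> 1"
    have [measurable]: "g \<in> borel_measurable borel"
      using g(1) by (intro borel_measurable_continuous_onI continuous_at_imp_continuous_on) auto
    have "{x. \<not> isCont (\<lambda>x. g (f x)) x} \<subseteq> {x. \<not> isCont f x}"
      using g(1) by (auto intro: isCont_o2)
    then have "emeasure M {x. \<not> isCont (\<lambda>x. g (f x)) x} = 0"
      using emeasure_mono[OF _ disc] null by (metis le_zero_eq)
    then have "(\<lambda>n. \<integral>x. g (f x) \<partial>M_seq n) \<longlonglongrightarrow> (\<integral>x. g (f x) \<partial>M)"
      using g(2) by (intro weak_conv_imp_bdd_ae_continuous_conv[OF M_seq M conv, where B = 1]) auto
    then show "(\<lambda>n. integral\<^sup>L (distr (M_seq n) borel f) g) \<longlonglongrightarrow> integral\<^sup>L (distr M borel f) g"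
      by (simp add: integral_distr)
  qed (auto intro!: M.real_distribution_distr M_seq.real_distribution_distr)
qed

section \<open>Empirical measures of eigenvalue lists\<close>

definition empirical_measure :: "real list \<Rightarrow> real measure" where
  "empirical_measure xs = distr (measure_pmf (pmf_of_set {..<length xs})) borel ((!) xs)"

text \<open>This covers the empty list too: \<open>pmf_of_set {}\<close> is unspecified but still a
  probability. Index 0 of a sequence can thus carry an arbitrary list.\<close>

lemma real_distribution_empirical_measure: "real_distribution (empirical_measure xs)"
  unfolding empirical_measure_def real_distribution_def real_distribution_axioms_def
  by (auto intro!: prob_space.prob_space_distr measure_pmf.prob_space_axioms)

text \<open>The uniform choice is among indices and not among values, so repeated eigenvalues count
  with their multiplicity.\<close>

lemma measure_empirical_measure:
  assumes "xs \<noteq> []" and [measurable]: "S \<in> sets borel"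
  shows "measure (empirical_measure xs) S = real (length (filter (\<lambda>x. x \<in> S) xs)) / real (length xs)"
proof -
  have "measure (empirical_measure xs) S
      = measure (measure_pmf (pmf_of_set {..<length xs})) ((!) xs -` S)"
    unfolding empirical_measure_def by (subst measure_distr) auto
  also have "\<dots> = real (card ({..<length xs} \<inter> (!) xs -` S)) / real (length xs)"
    using assms(1) by (subst measure_pmf_of_set) auto
  also have "{..<length xs} \<inter> (!) xs -` S = {i. i < length xs \<and> xs ! i \<in> S}"
    by auto
  finally show ?thesis by (simp add: length_filter_conv_card)
qed

lemma proots_linear_factors: "proots (\<Prod>l\<leftarrow>ls. [:- l, 1:]) = mset (ls :: 'a::idom list)"
proof (induction ls)
  case (Cons l ls)
  have "(\<Prod>l\<leftarrow>ls. [:- l, 1:]) \<noteq> 0"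
    by (auto simp: prod_list_zero_iff)
  with Cons show ?case
    by (simp add: proots_mult del: mult_pCons_left)
qed simp

text \<open>This links the counting function to a probability measure, for which the theory of weak
  convergence is available.\<close>

lemma esd_eq_cdf_empirical_measure:
  assumes "X \<in> carrier_mat n n" "char_poly X = (\<Prod>l\<leftarrow>ls. [:- l, 1:])" "length ls = n" "n > 0"
  shows "esd X x = cdf (empirical_measure (map Re ls)) x"
proof -
  have "esd X x = real (length (filter (\<lambda>l. Re l \<le> x) ls)) / real n"
    using assms by (simp add: esd_def proots_linear_factors flip: mset_filter)
  also have "\<dots> = cdf (empirical_measure (map Re ls)) x"
    using assms unfolding cdf_def
    by (subst measure_empirical_measure) (auto simp: filter_map o_def)
  finally show ?thesis .
qed

lemma eigenvalue_iff_mem_roots: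
  assumes "X \<in> carrier_mat n n" "char_poly X = (\<Prod>l\<leftarrow>ls. [:- l, 1:])"
  shows "eigenvalue X k \<longleftrightarrow> k \<in> set (ls :: complex list)"
  unfolding eigenvalue_root_char_poly[OF assms(1)] assms(2)
  by (auto simp: poly_prod_list prod_list_zero_iff o_def)

lemma esd_moebius:
  fixes X :: "complex mat" and p q r s :: real
  assumes X: "X \<in> carrier_mat n n" and n: "n > 0"
    and real: "real_spectrum X" and inv: "invertible_mat (lin_mat r s X)"
  defines "Y \<equiv> lin_mat p q X * inv_mat (lin_mat r s X)"
  shows "real_spectrum Y"
    and "\<exists>xs. esd X = cdf (empirical_measure xs) \<and>
      esd Y = cdf (distr (empirical_measure xs) borel (\<lambda>x. (p * x + q) / (r * x + s)))"
proof -
  define f where "f = (\<lambda>x. (p * x + q) / (r * x + s))"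
  have f_meas [measurable]: "f \<in> borel_measurable borel" unfolding f_def by measurable
  obtain ls where ls: "char_poly X = (\<Prod>l\<leftarrow>ls. [:- l, 1:])" "length ls = n"
    using char_poly_factorized[OF X] by blast
  define xs where "xs = map Re ls"
  \<comment> \<open>Since the spectrum is real, passing to real parts loses nothing and the complex
    Moebius map acts on the roots as the real function \<open>f\<close>.\<close>
  have Re: "of_real (Re l) = l" if "l \<in> set ls" for l
    using real that by (simp add: real_spectrum_def eigenvalue_iff_mem_roots[OF X ls(1)])
  have Y: "Y \<in> carrier_mat n n"
    unfolding Y_def using X by (auto intro!: mult_carrier_mat[of _ n n])
  define ks where "ks = map (\<lambda>x. complex_of_real (f x)) xs"
  have "char_poly Y = (\<Prod>l\<leftarrow>ls. [:- complex_of_real (f (Re l)), 1:])"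
    unfolding Y_def char_poly_moebius[OF X ls inv]
    by (intro arg_cong[where f = prod_list] map_cong refl) (simp add: f_def Re)
  then have ks: "char_poly Y = (\<Prod>k\<leftarrow>ks. [:- k, 1:])"
    by (simp add: ks_def xs_def o_def)
  show "real_spectrum Y"
    unfolding real_spectrum_def eigenvalue_iff_mem_roots[OF Y ks] by (auto simp: ks_def)
  have xs: "xs \<noteq> []" using ls(2) n by (auto simp: xs_def)
  have "esd Y x = cdf (distr (empirical_measure xs) borel f) x" for x
  proof -
    have [measurable]: "f -` {..x} \<in> sets borel"
      using measurable_sets_borel[OF f_meas] by simp
    interpret e: real_distribution "empirical_measure xs"
      by (rule real_distribution_empirical_measure)
    have [simp]: "Re \<circ> (\<lambda>x. complex_of_real (f x)) = f" by auto
    have "esd Y x = cdf (empirical_measure (map f xs)) x"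
      using esd_eq_cdf_empirical_measure[OF Y ks] n ls(2) by (simp add: ks_def xs_def o_def)
    also have "\<dots> = measure (empirical_measure xs) (f -` {..x})"
      unfolding cdf_def using xs
      by (subst (1 2) measure_empirical_measure) (auto simp: filter_map o_def)
    also have "\<dots> = cdf (distr (empirical_measure xs) borel f) x"
      unfolding cdf_def by (subst measure_distr) auto
    finally show ?thesis .
  qed
  then show "\<exists>xs. esd X = cdf (empirical_measure xs) \<and>
      esd Y = cdf (distr (empirical_measure xs) borel (\<lambda>x. (p * x + q) / (r * x + s)))"
    using esd_eq_cdf_empirical_measure[OF X ls n] by (auto simp: xs_def f_def)
qed

text \<open>The deterministic core of the limit statement, to be applied to a single outcome at a
  time.\<close>

lemma weak_conv_esd_moebius:
  fixes X :: "nat \<Rightarrow> complex mat" and p q r s :: real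
  assumes \<mu>: "real_distribution \<mu>" and conv: "weak_conv (\<lambda>n. esd (X n)) (cdf \<mu>)"
    and X: "\<And>n. n \<ge> 1 \<Longrightarrow> X n \<in> carrier_mat n n"
      "\<And>n. n \<ge> 1 \<Longrightarrow> real_spectrum (X n)"
      "\<And>n. n \<ge> 1 \<Longrightarrow> invertible_mat (lin_mat r s (X n))"
    and nonzero: "\<not> (r = 0 \<and> s = 0)" and null: "r \<noteq> 0 \<longrightarrow> measure \<mu> {- s / r} = 0"
  shows "weak_conv (\<lambda>n. esd (lin_mat p q (X n) * inv_mat (lin_mat r s (X n))))
    (cdf (distr \<mu> borel (\<lambda>x. (p * x + q) / (r * x + s))))"
proof -
  interpret real_distribution \<mu> by fact
  let ?f = "\<lambda>x. (p * x + q) / (r * x + s)"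
  let ?Y = "\<lambda>n. lin_mat p q (X n) * inv_mat (lin_mat r s (X n))"
  have "\<exists>xs. esd (X n) = cdf (empirical_measure xs) \<and>
      esd (?Y n) = cdf (distr (empirical_measure xs) borel ?f)" if "n \<ge> 1" for n
    using esd_moebius(2)[OF X(1) _ X(2,3), OF that _ that that] that by auto
  then obtain xs where xs:
    "\<And>n. n \<ge> 1 \<Longrightarrow> esd (X n) = cdf (empirical_measure (xs n))"
    "\<And>n. n \<ge> 1 \<Longrightarrow> esd (?Y n) = cdf (distr (empirical_measure (xs n)) borel ?f)"
    by metis
  \<comment> \<open>Sequences that agree from index 1 on have the same limits; the lists
    \<open>xs n\<close> are meaningful only from there on.\<close>
  have ev: "(\<lambda>n. F n x) \<longlonglongrightarrow> c \<longleftrightarrow> (\<lambda>n. G n x) \<longlonglongrightarrow> c"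
    if "\<And>n. n \<ge> 1 \<Longrightarrow> F n = G n" for F G :: "nat \<Rightarrow> real \<Rightarrow> real" and x c
    by (rule tendsto_cong) (use that in \<open>auto simp: eventually_sequentially intro!: exI[of _ 1]\<close>)
  have "weak_conv_m (\<lambda>n. empirical_measure (xs n)) \<mu>"
    using conv unfolding weak_conv_m_def weak_conv_def by (simp add: ev[OF xs(1)])
  moreover have "emeasure \<mu> {x. \<not> isCont ?f x} = 0"
  proof -
    \<comment> \<open>Only an inclusion holds in general: with division by zero returning 0, the
      function is continuous even at the pole when \<open>p = q = 0\<close>.\<close>
    have "{x. \<not> isCont ?f x} \<subseteq> {x. r * x + s = 0}"
      by (auto intro!: continuous_intros)
    also have "\<dots> \<subseteq> (if r = 0 then {} else {- s / r})"
      using nonzero by (auto simp: field_simps eq_neg_iff_add_eq_0)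
    finally have "emeasure \<mu> {x. \<not> isCont ?f x} \<le> emeasure \<mu> (if r = 0 then {} else {- s / r})"
      by (intro emeasure_mono) auto
    also have "\<dots> = 0" using null by (auto simp: emeasure_eq_measure)
    finally show ?thesis by simp
  qed
  ultimately have "weak_conv_m (\<lambda>n. distr (empirical_measure (xs n)) borel ?f) (distr \<mu> borel ?f)"
    by (intro weak_conv_m_distr[OF real_distribution_empirical_measure \<mu>]) measurable
  then show ?thesis
    unfolding weak_conv_m_def weak_conv_def by (simp add: ev[OF xs(2)])
qed

subsection \<open>Algebraic laws\<close>

text \<open>Needed to evaluate polynomials that are built as sums and products of other bivariate
  polynomials.\<close>

lemma comm_ring_hom_eval2: "comm_ring_hom (\<lambda>L. eval2 L m z)"
proof -
  interpret r: map_poly_comm_ring_hom complex_of_real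
    by unfold_locales auto
  interpret h: comm_ring_hom "\<lambda>c. poly (map_poly complex_of_real c) z"
    by unfold_locales (simp_all add: hom_distribs)
  interpret hh: map_poly_comm_ring_hom "\<lambda>c. poly (map_poly complex_of_real c) z" ..
  show ?thesis
    by unfold_locales (simp_all add: eval2_def hom_distribs)
qed

lemma poly_of_real_pCons:
  "poly (map_poly complex_of_real (pCons a c)) z = a + z * poly (map_poly complex_of_real c) z"
  by (cases "a = 0 \<and> c = 0") (auto simp: map_poly_pCons)

lemma eval2_pCons: "eval2 (pCons c L) m z = poly (map_poly complex_of_real c) z + m * eval2 L m z"
  by (cases "c = 0 \<and> L = 0") (auto simp: eval2_def map_poly_pCons)

lemma eval2_const: "eval2 [:c:] m z = poly (map_poly complex_of_real c) z"
  by (cases "c = 0") (simp_all add: eval2_def map_poly_pCons)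

lemma eval2_0 [simp]: "eval2 0 m z = 0"
  by (simp add: eval2_def)

lemma eval2_const_const: "eval2 [:[:c:]:] m z = complex_of_real c"
  by (cases "c = 0") (simp_all add: eval2_const map_poly_pCons)

lemma poly_eq_sum_degree_le:
  fixes p :: "'a::comm_semiring_1 poly"
  assumes "degree p \<le> n"
  shows "poly p x = (\<Sum>i\<le>n. coeff p i * x ^ i)"
  unfolding poly_altdef
  by (rule sum.mono_neutral_left) (use assms in \<open>auto simp: coeff_eq_0\<close>)

text \<open>A common bound \<open>K\<close> for all inner degrees makes the range of summation a
  rectangle, so that later one power of the denominator serves all terms.\<close>

lemma eval2_eq_sum:
  assumes "\<And>i. degree (coeff L i) \<le> K"
  shows "eval2 L m z =
    (\<Sum>i\<le>degree L. \<Sum>j\<le>K. complex_of_real (coeff (coeff L i) j) * m ^ i * z ^ j)"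
proof -
  have inner: "poly (map_poly complex_of_real c) z = (\<Sum>j\<le>K. complex_of_real (coeff c j) * z ^ j)"
    if "degree c \<le> K" for c
  proof -
    have "poly (map_poly complex_of_real c) z
        = (\<Sum>j\<le>K. coeff (map_poly complex_of_real c) j * z ^ j)"
      using that by (intro poly_eq_sum_degree_le) (auto intro: order_trans[OF degree_map_poly_le])
    then show ?thesis by (simp add: coeff_map_poly)
  qed
  have "eval2 L m z = (\<Sum>i\<le>degree L. poly (map_poly complex_of_real (coeff L i)) z * m ^ i)"
    unfolding eval2_def
    by (subst poly_eq_sum_degree_le[of _ "degree L"]) (auto simp: coeff_map_poly degree_map_poly_le)
  then show ?thesis
    by (simp add: inner[OF assms] sum_distrib_left sum_distrib_right mult_ac)
qed

lemma degree_coeff_bound: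
  fixes L :: "'a::zero poly poly"
  obtains K where "\<And>i. degree (coeff L i) \<le> K"
proof
  show "degree (coeff L i) \<le> (\<Sum>i\<le>degree L. degree (coeff L i))" for i
  proof (cases "i \<le> degree L")
    case True
    then show ?thesis by (intro member_le_sum) auto
  qed (simp add: coeff_eq_0)
qed

text \<open>The coefficients are real, so conjugation passes through the double sum.\<close>

lemma eval2_cnj: "eval2 L (cnj m) (cnj z) = cnj (eval2 L m z)"
proof -
  obtain K where "\<And>i. degree (coeff L i) \<le> K" using degree_coeff_bound by blast
  then show ?thesis by (simp add: eval2_eq_sum[of L K])
qed

text \<open>Homogenisation in the second argument: with \<open>K\<close> bounding the degree in
  \<open>z\<close>, each power \<open>z^j\<close> is replaced by \<open>V^j Q^(K-j)\<close>. The
  first argument is replaced by the polynomial \<open>U\<close> and contributes no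
  denominator.\<close>

lemma eval2_clear_denominator:
  "\<exists>L' K. \<forall>m z. eval2 Q m z \<noteq> 0 \<longrightarrow>
    eval2 L' m z = eval2 Q m z ^ K * eval2 L (eval2 U m z) (eval2 V m z / eval2 Q m z)"
proof -
  obtain K where K: "\<And>i. degree (coeff L i) \<le> K" using degree_coeff_bound by blast
  define L' where "L' = (\<Sum>i\<le>degree L. \<Sum>j\<le>K. [:[:coeff (coeff L i) j:]:] * U ^ i * V ^ j * Q ^ (K - j))"
  have "eval2 L' m z = eval2 Q m z ^ K * eval2 L (eval2 U m z) (eval2 V m z / eval2 Q m z)"
    if nz: "eval2 Q m z \<noteq> 0" for m z
  proof -
    interpret e: comm_ring_hom "\<lambda>L. eval2 L m z" by (rule comm_ring_hom_eval2)
    have "eval2 L' m z = (\<Sum>i\<le>degree L. \<Sum>j\<le>K. complex_of_real (coeff (coeff L i) j) *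
        eval2 U m z ^ i * eval2 V m z ^ j * eval2 Q m z ^ (K - j))"
      by (simp add: L'_def e.hom_sum e.hom_mult e.hom_power eval2_const_const mult_ac del: mult_pCons_left mult_pCons_right)
    also have "\<dots> = eval2 Q m z ^ K * eval2 L (eval2 U m z) (eval2 V m z / eval2 Q m z)"
      unfolding eval2_eq_sum[OF K] sum_distrib_left
      by (intro sum.cong refl) (use nz in \<open>simp add: power_diff power_divide\<close>)
    finally show ?thesis .
  qed
  then show ?thesis by blast
qed

text \<open>Choosing \<open>z\<close> first, outside \<open>F\<close> and off the roots of the
  leading coefficient, leaves a nonzero polynomial in \<open>m\<close>. The set \<open>F\<close>
  serves to avoid the pole of a Moebius map.\<close>

lemma eval2_nonzero:
  assumes "L \<noteq> 0" "finite F"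
  obtains m z where "z \<notin> F" "eval2 L m z \<noteq> 0"
proof -
  define c where "c = map_poly complex_of_real (lead_coeff L)"
  have c: "c \<noteq> 0"
    using assms(1) by (simp add: c_def map_poly_eq_0_iff)
  then have "finite ({z. poly c z = 0} \<union> F)"
    using assms(2) by (simp add: poly_roots_finite)
  then obtain z where z: "z \<notin> {z. poly c z = 0} \<union> F"
    using ex_new_if_finite infinite_UNIV_char_0 by blast
  define M where "M = map_poly (\<lambda>c. poly (map_poly complex_of_real c) z) L"
  have "coeff M (degree L) \<noteq> 0"
    using z by (simp add: M_def coeff_map_poly c_def)
  then have "M \<noteq> 0" by auto
  then obtain m where "poly M m \<noteq> 0"
    using poly_all_0_iff_0 by blast
  then show ?thesis
    using z that by (auto simp: eval2_def M_def)
qed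

section \<open>Stieltjes transforms under Moebius maps\<close>

lemma stieltjes_integrable:
  assumes "real_distribution \<mu>" "Im w \<noteq> 0"
  shows "integrable \<mu> (\<lambda>x. 1 / (complex_of_real x - w))"
proof -
  interpret real_distribution \<mu> by fact
  show ?thesis
  proof (rule integrable_const_bound[where B = "1 / \<bar>Im w\<bar>"])
    \<comment> \<open>The distance from \<open>w\<close> to the real line is the absolute value of
      its imaginary part.\<close>
    have "norm (1 / (complex_of_real x - w)) \<le> 1 / \<bar>Im w\<bar>" for x
      using abs_Im_le_cmod[of "complex_of_real x - w"] assms(2)
      by (auto simp: norm_divide intro!: divide_left_mono mult_pos_pos)
    then show "AE x in \<mu>. norm (1 / (complex_of_real x - w)) \<le> 1 / \<bar>Im w\<bar>" by simp
  qed measurable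
qed

lemma stieltjes_cnj: "stieltjes \<mu> (cnj w) = cnj (stieltjes \<mu> w)"
  unfolding stieltjes_def by (subst Bochner_Integration.integral_cnj[symmetric]) simp

lemma eval2_stieltjes_off_real_axis:
  assumes "\<And>z. Im z > 0 \<Longrightarrow> eval2 L (stieltjes \<mu> z) z = 0" and "Im w \<noteq> 0"
  shows "eval2 L (stieltjes \<mu> w) w = 0"
proof (cases "Im w > 0")
  case False
  then have "eval2 L (stieltjes \<mu> (cnj w)) (cnj w) = 0" using assms by simp
  then show ?thesis by (simp add: stieltjes_cnj eval2_cnj)
qed (use assms in simp)

lemma AE_moebius_denominator:
  fixes r s :: real
  assumes "real_distribution \<mu>" and nonzero: "\<not> (r = 0 \<and> s = 0)"
    and null: "r \<noteq> 0 \<longrightarrow> measure \<mu> {- s / r} = 0"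
  shows "AE x in \<mu>. r * x + s \<noteq> 0"
proof -
  interpret real_distribution \<mu> by fact
  show ?thesis
  proof (cases "r = 0")
    case False
    then have "AE x in \<mu>. x \<notin> {- s / r}"
      using null by (intro AE_not_in) (auto simp: null_sets_def emeasure_eq_measure)
    then show ?thesis
      by eventually_elim (use False in \<open>auto simp: field_simps eq_neg_iff_add_eq_0\<close>)
  qed (use nonzero in auto)
qed

text \<open>The point \<open>w\<close> is the preimage of \<open>z\<close> under the Moebius map. As
  a function of \<open>x\<close>, the transformed kernel is a quotient of linear functions with a
  pole at \<open>w\<close>; its partial fraction decomposition is integrated term by term.\<close>

lemma stieltjes_moebius:
  fixes p q r s :: real and z :: complex
  assumes "real_distribution \<mu>" and null: "r \<noteq> 0 \<longrightarrow> measure \<mu> {- s / r} = 0"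
    and D: "p * s - q * r \<noteq> 0" and z: "Im z > 0"
  defines "w \<equiv> (s * z - q) / (p - r * z)"
  shows "Im w \<noteq> 0" "p - r * z \<noteq> 0"
    and "stieltjes (distr \<mu> borel (\<lambda>x. (p * x + q) / (r * x + s))) z =
      r / (p - r * z) + (p * s - q * r) / (p - r * z)\<^sup>2 * stieltjes \<mu> w"
proof -
  interpret real_distribution \<mu> by fact
  show nz: "p - r * z \<noteq> 0"
    using D z by (auto simp: complex_eq_iff)
  \<comment> \<open>Making the denominator real shows that \<open>Im w\<close> has the sign of
    \<open>p s - q r\<close>.\<close>
  have "w * of_real ((cmod (p - r * z))\<^sup>2) = (s * z - q) * cnj (p - r * z)"
    unfolding complex_norm_square w_def using nz by simp
  then have "Im (w * of_real ((cmod (p - r * z))\<^sup>2)) = Im ((s * z - q) * cnj (p - r * z))"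
    by simp
  then have "Im w * (cmod (p - r * z))\<^sup>2 = (p * s - q * r) * Im z"
    by (simp add: algebra_simps)
  then show w: "Im w \<noteq> 0"
    using D z by auto
  have AE: "AE x in \<mu>. r * x + s \<noteq> 0"
    using D by (intro AE_moebius_denominator assms(1) null) auto
  have "stieltjes (distr \<mu> borel (\<lambda>x. (p * x + q) / (r * x + s))) z =
      (\<integral>x. 1 / (complex_of_real ((p * x + q) / (r * x + s)) - z) \<partial>\<mu>)"
    unfolding stieltjes_def by (rule integral_distr) measurable
  also have "\<dots> = (\<integral>x. r / (p - r * z) +
      (p * s - q * r) / (p - r * z)\<^sup>2 * (1 / (complex_of_real x - w)) \<partial>\<mu>)"
  proof (rule integral_cong_AE)
    show "AE x in \<mu>. 1 / (complex_of_real ((p * x + q) / (r * x + s)) - z) =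
      r / (p - r * z) + (p * s - q * r) / (p - r * z)\<^sup>2 * (1 / (complex_of_real x - w))"
      using AE
    proof eventually_elim
      case (elim x)
      define e where "e = complex_of_real (r * x + s)"
      have e: "e \<noteq> 0" using elim unfolding e_def of_real_eq_0_iff .
      define d where "d = p - r * z"
      have d: "d \<noteq> 0" using nz by (simp add: d_def)
      define y where "y = d * (x - w)"
      have "d * w = s * z - q" using d by (simp add: w_def d_def)
      then have y: "y = (p - r * z) * x - (s * z - q)"
        by (simp add: y_def right_diff_distrib) (simp add: d_def)
      have "x - w \<noteq> 0" using w by (auto simp: complex_eq_iff)
      then have y0: "y \<noteq> 0" using d by (simp add: y_def)
      have "complex_of_real ((p * x + q) / (r * x + s)) - z = (p * x + q) / e - z"
        by (simp add: e_def)
      also have "\<dots> = y / e"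
        using e unfolding y by (simp add: field_simps) (simp add: e_def algebra_simps)
      finally have "1 / (complex_of_real ((p * x + q) / (r * x + s)) - z) = e / y" by simp
      also have "e / y = (r * y + (p * s - q * r)) / (d * y)"
      proof -
        \<comment> \<open>Division with remainder of one linear function of \<open>x\<close> by
          another; it yields the partial fractions.\<close>
        have "e * d = r * y + (p * s - q * r)"
          by (simp add: e_def d_def y algebra_simps)
        then show ?thesis using d y0 by (simp add: field_simps)
      qed
      also have "\<dots> = r / d + (p * s - q * r) / d\<^sup>2 * (1 / (x - w))"
        using d y0 \<open>x - w \<noteq> 0\<close> by (simp add: y_def field_simps power2_eq_square)
      finally show ?case by (simp add: d_def)
    qed
  qed measurable
  also have "\<dots> = r / (p - r * z) + (p * s - q * r) / (p - r * z)\<^sup>2 * stieltjes \<mu> w"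
    unfolding stieltjes_def using stieltjes_integrable[OF assms(1) w] prob_space
    by (subst Bochner_Integration.integral_add)
       (auto simp del: times_divide_eq_left times_divide_eq_right mult_1_right)
  finally show "stieltjes (distr \<mu> borel (\<lambda>x. (p * x + q) / (r * x + s))) z =
      r / (p - r * z) + (p * s - q * r) / (p - r * z)\<^sup>2 * stieltjes \<mu> w" .
qed

lemma algebraic_law_moebius:
  fixes p q r s :: real
  assumes \<mu>: "real_distribution \<mu>" and alg: "algebraic_law \<mu>"
    and null: "r \<noteq> 0 \<longrightarrow> measure \<mu> {- s / r} = 0" and nz: "p * s - q * r \<noteq> 0"
  shows "algebraic_law (distr \<mu> borel (\<lambda>x. (p * x + q) / (r * x + s)))"
proof -
  define D where "D = p * s - q * r"
  have D0: "D \<noteq> 0" using assms by (simp add: D_def)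
  obtain L where L: "L \<noteq> 0" "\<And>z. Im z > 0 \<Longrightarrow> eval2 L (stieltjes \<mu> z) z = 0"
    using alg by (auto simp: algebraic_law_def)
  define Q :: "real poly poly" where "Q = [:[:p, - r:]:]"
  define V :: "real poly poly" where "V = [:[:- q, s:]:]"
  \<comment> \<open>The Stieltjes relation solved for the transform of \<mu> at \<open>w\<close>.
    Only the constant \<open>D\<close> is divided by, so \<open>U\<close> is a polynomial in
    \<open>m\<close> and \<open>z\<close>, while \<open>w\<close> is the quotient of
    \<open>V\<close> and \<open>Q\<close>.\<close>
  define U :: "real poly poly" where "U = [:[:- r / D:] * [:p, - r:], [:1 / D:] * [:p, - r:]\<^sup>2:]"
  have Q: "eval2 Q m z = p - r * z" and V: "eval2 V m z = s * z - q" for m z :: complex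
    by (simp_all add: Q_def V_def eval2_const poly_of_real_pCons algebra_simps)
  have U: "eval2 U m z = ((p - r * z)\<^sup>2 * m - r * (p - r * z)) / D" for m z :: complex
    using D0 by (simp add: U_def eval2_pCons poly_of_real_pCons power2_eq_square field_simps)
  obtain L' K where L': "\<And>m z. eval2 Q m z \<noteq> 0 \<Longrightarrow>
      eval2 L' m z = eval2 Q m z ^ K * eval2 L (eval2 U m z) (eval2 V m z / eval2 Q m z)"
    using eval2_clear_denominator[of Q L U V] by blast
  \<comment> \<open>The excluded value \<open>-s/r\<close> is the pole of the Moebius map, which no
    finite \<open>z\<close> corresponds to.\<close>
  obtain u w where uw: "w \<notin> (if r = 0 then {} else {- complex_of_real s / r})" "eval2 L u w \<noteq> 0"
    by (rule eval2_nonzero[OF L(1), of "if r = 0 then {} else {- complex_of_real s / r}"]) auto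
  have "L' \<noteq> 0"
  proof
    assume "L' = 0"
    define e where "e = complex_of_real r * w + s"
    have e: "e \<noteq> 0"
      using uw(1) D0 by (cases "r = 0") (auto simp: e_def D_def field_simps eq_neg_iff_add_eq_0)
    \<comment> \<open>With \<open>m\<close> below, this is the preimage of \<open>(u, w)\<close>
      under the substitution: \<open>z\<close> is the image of \<open>w\<close>, and
      \<open>m\<close> solves \<open>U(m, z) = u\<close>.\<close>
    define z where "z = (complex_of_real p * w + q) / e"
    have pz: "p - r * z = D / e"
      using e by (simp add: z_def field_simps) (simp add: e_def D_def algebra_simps)
    have pz0: "p - r * z \<noteq> 0" using e D0 by (simp add: pz)
    have sz: "s * z - q = w * (D / e)"
      using e by (simp add: z_def field_simps) (simp add: e_def D_def algebra_simps)
    define m where "m = (u * D + r * (p - r * z)) / (p - r * z)\<^sup>2"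
    have "eval2 U m z = u"
      using pz0 D0 by (simp add: U m_def)
    moreover have "eval2 V m z / eval2 Q m z = w"
      using e D0 by (simp add: V Q sz pz)
    ultimately have "eval2 L' m z \<noteq> 0"
      using L'[of m z] pz0 uw(2) by (simp add: Q)
    then show False using \<open>L' = 0\<close> by simp
  qed
  moreover have "eval2 L' (stieltjes (distr \<mu> borel (\<lambda>x. (p * x + q) / (r * x + s))) z) z = 0"
    if z: "Im z > 0" for z
  proof -
    note st = stieltjes_moebius[OF \<mu> null nz z]
    define w where "w = (s * z - q) / (p - r * z)"
    define m where "m = stieltjes (distr \<mu> borel (\<lambda>x. (p * x + q) / (r * x + s))) z"
    have m: "m = r / (p - r * z) + D / (p - r * z)\<^sup>2 * stieltjes \<mu> w"
      using st(3) by (simp add: m_def w_def D_def)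
    have "eval2 U m z = stieltjes \<mu> w"
    proof -
      have "(e\<^sup>2 * (r / e + D / e\<^sup>2 * x) - r * e) / D = x" if "e \<noteq> 0" for e x :: complex
        using that D0 by (simp add: field_simps power2_eq_square)
      from this[OF st(2)] show ?thesis by (simp add: U m)
    qed
    then have "eval2 L' m z = (p - r * z) ^ K * eval2 L (stieltjes \<mu> w) w"
      using L'[of m z] st(2) by (simp add: Q V w_def)
    also have "eval2 L (stieltjes \<mu> w) w = 0"
      using eval2_stieltjes_off_real_axis[OF L(2)] st(1) by (simp add: w_def)
    finally show ?thesis by (simp add: m_def)
  qed
  ultimately show ?thesis unfolding algebraic_law_def by blast
qed

text \<open>The image law is the point mass at \<open>c\<close>, whose transform
  \<open>1 / (c - z)\<close> is a root of \<open>(c - z) m - 1\<close>.\<close>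

lemma algebraic_law_AE_const:
  assumes "prob_space \<mu>" and [measurable]: "f \<in> borel_measurable \<mu>" and "AE x in \<mu>. f x = c"
  shows "algebraic_law (distr \<mu> borel f)"
proof -
  interpret prob_space \<mu> by fact
  have st: "stieltjes (distr \<mu> borel f) z = 1 / (c - z)" for z :: complex
  proof -
    have "stieltjes (distr \<mu> borel f) z = (\<integral>x. 1 / (complex_of_real (f x) - z) \<partial>\<mu>)"
      unfolding stieltjes_def by (rule integral_distr) measurable
    also have "\<dots> = (\<integral>x. 1 / (complex_of_real c - z) \<partial>\<mu>)"
      using assms(3) by (intro integral_cong_AE) auto
    finally show ?thesis by (simp add: prob_space)
  qed
  have "eval2 [:[:- 1:], [:c, - 1:]:] (stieltjes (distr \<mu> borel f) z) z = 0" if "Im z > 0" for z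
  proof -
    have "c - z \<noteq> 0" using that by (auto simp: complex_eq_iff)
    then show ?thesis by (simp add: st eval2_pCons poly_of_real_pCons field_simps)
  qed
  moreover have "[:[:- 1:], [:c, - 1:]:] \<noteq> (0 :: real poly poly)" by simp
  ultimately show ?thesis unfolding algebraic_law_def by blast
qed

section \<open>Almost sure limit and conclusion\<close>

lemma limit_law_moebius:
  fixes p q r s :: real
  assumes lim: "limit_law P A \<mu>"
    and nonzero: "\<not> (r = 0 \<and> s = 0)" and null: "r \<noteq> 0 \<longrightarrow> measure \<mu> {- s / r} = 0"
    and inv: "\<forall>N \<ge> 1. AE w in P. invertible_mat (lin_mat r s (A N w))"
  shows "limit_law P (\<lambda>N w. lin_mat p q (A N w) * inv_mat (lin_mat r s (A N w)))
    (distr \<mu> borel (\<lambda>x. (p * x + q) / (r * x + s)))"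
proof -
  have rand: "random_mat P N (A N)" and spec: "AE w in P. real_spectrum (A N w)" if "N \<ge> 1" for N
    using lim that by (auto simp: limit_law_def)
  have \<mu>: "real_distribution \<mu>" and conv: "AE w in P. weak_conv (\<lambda>N. esd (A N w)) (cdf \<mu>)"
    using lim by (auto simp: limit_law_def)
  interpret real_distribution \<mu> by fact
  have carrier: "A N w \<in> carrier_mat N N" if "N \<ge> 1" "w \<in> space P" for N w
    using rand[OF that(1)] that(2) by (simp add: random_mat_def)
  show ?thesis
    unfolding limit_law_def
  proof (intro conjI allI impI)
    fix N :: nat assume N: "N \<ge> 1"
    show "random_mat P N (\<lambda>w. lin_mat p q (A N w) * inv_mat (lin_mat r s (A N w)))"
      by (intro random_mat_mult random_mat_inv_mat random_mat_lin_mat rand N)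
    show "AE w in P. real_spectrum (lin_mat p q (A N w) * inv_mat (lin_mat r s (A N w)))"
      using spec[OF N] inv[rule_format, OF N] AE_space
      by eventually_elim (use esd_moebius(1)[OF carrier[OF N]] N in auto)
  next
    \<comment> \<open>A countable union of null sets is null, so one exceptional set serves all
      \<open>N\<close>.\<close>
    have "AE w in P. \<forall>N. N \<ge> 1 \<longrightarrow>
        real_spectrum (A N w) \<and> invertible_mat (lin_mat r s (A N w))"
      using spec inv by (auto simp: AE_all_countable)
    with conv AE_space
    show "AE w in P. weak_conv (\<lambda>N. esd (lin_mat p q (A N w) * inv_mat (lin_mat r s (A N w))))
        (cdf (distr \<mu> borel (\<lambda>x. (p * x + q) / (r * x + s))))"
    proof eventually_elim
      case (elim w)
      then show ?case
        by (intro weak_conv_esd_moebius[OF \<mu> _ carrier]) (use nonzero null in auto)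
    qed
  qed (intro real_distribution_distr, measurable)
qed

theorem theorem5p6:
  fixes P :: "'w measure"
    and A :: "nat \<Rightarrow> 'w \<Rightarrow> complex mat"
    and \<mu> :: "real measure"
    and p q r s :: real
  assumes "prob_space P"
    and "limit_law P A \<mu>"
    and "algebraic_law \<mu>"
    and "\<not> (r = 0 \<and> s = 0)"
    and "r \<noteq> 0 \<longrightarrow> measure \<mu> {- s / r} = 0"
    and "\<forall>N \<ge> 1. AE w in P. invertible_mat (lin_mat r s (A N w))"
  shows "\<exists>\<nu>. limit_law P (\<lambda>N w. lin_mat p q (A N w) * inv_mat (lin_mat r s (A N w))) \<nu>
             \<and> algebraic_law \<nu>"
proof -
  let ?f = "\<lambda>x. (p * x + q) / (r * x + s)"
  have \<mu>: "real_distribution \<mu>" using assms(2) by (simp add: limit_law_def)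
  interpret real_distribution \<mu> by fact
  have "algebraic_law (distr \<mu> borel ?f)"
  proof (cases "p * s - q * r = 0")
    case True
    \<comment> \<open>When \<open>p s = q r\<close>, the numerator is \<open>c\<close> times the
      denominator; for \<open>r = 0\<close>, \<open>s\<close> is nonzero and \<open>p\<close> must
      vanish.\<close>
    define c where "c = (if r = 0 then q / s else p / r)"
    have "?f x = c" if "r * x + s \<noteq> 0" for x
      using True assms(4) that by (auto simp: c_def field_simps)
    then have "AE x in \<mu>. ?f x = c"
      using AE_moebius_denominator[OF \<mu> assms(4,5)] by auto
    then show ?thesis
      by (intro algebraic_law_AE_const[where c = c] prob_space_axioms) measurable
  next
    case False
    then show ?thesis by (intro algebraic_law_moebius \<mu> assms(3,5))
  qed
  then show ?thesis
    using limit_law_moebius[OF assms(2,4-6)] by blast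
qed

end
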